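(* Consider a continuous-time birth-and-death process with state space $S\subset\mathbb Z$ (a set of consecutive integers), generator $\mathcal L$ and (reversible) stationary distribution $\nu$. Let $K=\{m,\dots,M\}$ be a connected subset of $S$, let $\nu_K(x)=\nu(x)/\sum_{y\in K}\nu(y)$ for $x\in K$ (and $0$ otherwise), and $Q_K(x,y)=\nu_K(x)\mathcal L(x,y)$. Assume that for some constant $C_P$, $$\mathrm{Var}_\nu(f)\le C_P\,\langle f,-\mathcal Lf\rangle_\nu\qquad\forall f\in\ell_{2,\nu}.$$ Then $$\mathrm{Var}_{\nu_K}(f)\le C_P\sum_{x:\,x,x+1\in K}Q_K(x,x+1)\,(f(x)-f(x+1))^2\qquad\forall f\in\ell_{2,\nu_K}.$$
   Context: $\mathcal L(x,y)$ is the transition rate from $x$ to $y\ne x$, which vanishes unless $|x-y|=1$, and $\nu(x)\mathcal L(x,y)=\nu(y)\mathcal L(y,x)$. For a distribution $\mu$, $\ell_{2,\mu}$ is the space of functions square-integrable with respect to $\mu$, $\langle f,g\rangle_\mu=\sum_x\mu(x)f(x)g(x)$, and $\mathrm{Var}_\mu(f)=\mathbb E_\mu[f^2]-\mathbb E_\mu[f]^2$. The Dirichlet form of the birth-and-death process is $\langle f,-\mathcal Lf\rangle_\nu=\sum_{x:\,x,x+1\in S}\nu(x)\mathcal L(x,x+1)(f(x)-f(x+1))^2$. *)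

theory Defs
  imports "HOL-Probability.Probability"
begin

definition consecutive_integers :: "int set \<Rightarrow> bool" where
  "consecutive_integers S \<longleftrightarrow> (\<forall>x\<in>S. \<forall>z\<in>S. \<forall>y. x \<le> y \<and> y \<le> z \<longrightarrow> y \<in> S)"

text \<open>Only the off-diagonal entries of \<open>L\<close>, the transition rates, are constrained and used.
  Neighbouring rates may vanish, so irreducibility is not assumed.\<close>

locale birth_death_process =
  fixes S :: "int set" and L :: "int \<Rightarrow> int \<Rightarrow> real" and \<nu> :: "int pmf"
  assumes consecutive: "consecutive_integers S"
    and rate_nonneg: "\<And>x y. \<lbrakk>x \<in> S; y \<in> S; x \<noteq> y\<rbrakk> \<Longrightarrow> L x y \<ge> 0"
    and rate_nearest_neighbour:
      "\<And>x y. \<lbrakk>x \<in> S; y \<in> S; x \<noteq> y; \<bar>x - y\<bar> \<noteq> 1\<rbrakk> \<Longrightarrow> L x y = 0"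
    and support: "set_pmf \<nu> \<subseteq> S"
    and reversible: "\<And>x y. \<lbrakk>x \<in> S; y \<in> S; x \<noteq> y\<rbrakk> \<Longrightarrow> pmf \<nu> x * L x y = pmf \<nu> y * L y x"

definition l2 :: "int pmf \<Rightarrow> (int \<Rightarrow> real) set" where
  "l2 \<mu> = {f. integrable (measure_pmf \<mu>) (\<lambda>x. (f x)\<^sup>2)}"

lemma variance_l2:
  assumes "f \<in> l2 \<mu>"
  shows "measure_pmf.variance \<mu> f =
    measure_pmf.expectation \<mu> (\<lambda>x. (f x)\<^sup>2) - (measure_pmf.expectation \<mu> f)\<^sup>2"
proof -
  have "integrable (measure_pmf \<mu>) (\<lambda>x. (f x)\<^sup>2)"
    using assms by (simp add: l2_def)
  moreover from this have "integrable (measure_pmf \<mu>) f"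
    by (intro measure_pmf.square_integrable_imp_integrable[of f \<mu>]) simp_all
  ultimately show ?thesis
    by (rule measure_pmf.variance_eq[rotated])
qed

text \<open>If \<open>S\<close> is infinite, the Dirichlet form of a function in \<open>l2 \<nu>\<close> may be infinite. It is
  therefore \<open>ereal\<close>-valued: a real \<open>infsum\<close> would be 0 for a divergent sum.\<close>

definition dirichlet_form ::
  "int set \<Rightarrow> (int \<Rightarrow> int \<Rightarrow> real) \<Rightarrow> int pmf \<Rightarrow> (int \<Rightarrow> real) \<Rightarrow> ereal" where
  "dirichlet_form S L \<nu> f =
    (\<Sum>\<^sub>\<infinity>x\<in>{x. x \<in> S \<and> x + 1 \<in> S}. ereal (pmf \<nu> x * L x (x + 1) * (f x - f (x + 1))\<^sup>2))"

text \<open>The normalised restriction of \<open>\<nu>\<close> to \<open>K\<close> is \<open>cond_pmf \<nu> K\<close>; the library leaves this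
  unspecified when \<open>K\<close> is a null set.\<close>

lemma pmf_cond_sum:
  assumes "finite K" "measure_pmf.prob \<nu> K > 0"
  shows "pmf (cond_pmf \<nu> K) x = (if x \<in> K then pmf \<nu> x / (\<Sum>y\<in>K. pmf \<nu> y) else 0)"
proof -
  have "set_pmf \<nu> \<inter> K \<noteq> {}"
    using assms(2) measure_pmf_zero_iff[of \<nu> K] by force
  then show ?thesis
    using assms(1) by (simp add: pmf_cond measure_measure_pmf_finite)
qed

definition edge_measure ::
  "int pmf \<Rightarrow> (int \<Rightarrow> int \<Rightarrow> real) \<Rightarrow> int set \<Rightarrow> int \<Rightarrow> int \<Rightarrow> real" where
  "edge_measure \<nu> L K x y = pmf (cond_pmf \<nu> K) x * L x y"

end

theory Submission imports Defs begin

text \<open>Extend \<open>f\<close> from \<open>K = {m..M}\<close> to a function \<open>g\<close> on all integers that is constant to the left of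
  \<open>m\<close> and to the right of \<open>M\<close>. No edge outside \<open>K\<close> contributes to the Dirichlet form of \<open>g\<close>, while
  the variance of \<open>g\<close>, as a mean square deviation from the mean of \<open>g\<close>, only decreases when
  restricted to \<open>K\<close>, and the mean square deviation of \<open>f\<close> under \<open>cond_pmf \<nu> K\<close> from any constant is
  at least its variance. Dividing by the mass of \<open>K\<close> gives the claim.\<close>

text \<open>Expanding the square, the deviation from \<open>c\<close> exceeds the variance by
  exactly \<open>(expectation f - c)\<^sup>2\<close>.\<close>

lemma (in prob_space) variance_le_square_deviation:
  fixes f :: "'a \<Rightarrow> real"
  assumes "integrable M f" "integrable M (\<lambda>x. (f x)\<^sup>2)"
  shows "variance f \<le> expectation (\<lambda>x. (f x - c)\<^sup>2)"
proof -
  have "expectation (\<lambda>x. (f x - c)\<^sup>2) = expectation (\<lambda>x. (f x)\<^sup>2 - 2 * c * f x + c\<^sup>2)"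
    by (simp add: power2_diff algebra_simps)
  also have "\<dots> = expectation (\<lambda>x. (f x)\<^sup>2) - 2 * c * expectation f + c\<^sup>2"
    using assms by (simp add: prob_space)
  also have "\<dots> = variance f + (expectation f - c)\<^sup>2"
    using assms by (simp add: variance_eq power2_eq_square algebra_simps prob_space)
  finally show ?thesis
    by simp
qed

text \<open>The factor \<open>measure_pmf.prob \<mu> K\<close> clears the normalising denominator,
  so that the sum over \<open>K\<close> can be compared with an expectation under
  \<open>\<mu>\<close>.\<close>

lemma expectation_cond_pmf_finite:
  fixes h :: "'a \<Rightarrow> real"
  assumes "finite K" "measure_pmf.prob \<mu> K > 0"
  shows "measure_pmf.prob \<mu> K * measure_pmf.expectation (cond_pmf \<mu> K) h =
    (\<Sum>x\<in>K. pmf \<mu> x * h x)"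
proof -
  have ne: "set_pmf \<mu> \<inter> K \<noteq> {}"
    using assms(2) measure_pmf_zero_iff[of \<mu> K] by force
  have "measure_pmf.expectation (cond_pmf \<mu> K) h = (\<Sum>x\<in>K. pmf (cond_pmf \<mu> K) x * h x)"
    using assms(1) by (subst integral_measure_pmf[where A = K]) (auto simp: set_cond_pmf[OF ne])
  also have "\<dots> = (\<Sum>x\<in>K. pmf \<mu> x * h x) / measure_pmf.prob \<mu> K"
    by (simp add: pmf_cond[OF ne] sum_divide_distrib)
  finally show ?thesis
    using assms(2) by simp
qed

lemma variance_cond_pmf_le:
  fixes f g :: "int \<Rightarrow> real"
  assumes "finite K" "measure_pmf.prob \<mu> K > 0" "g \<in> l2 \<mu>" "\<And>x. x \<in> K \<Longrightarrow> g x = f x"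
  shows "measure_pmf.prob \<mu> K * measure_pmf.variance (cond_pmf \<mu> K) f
    \<le> measure_pmf.variance \<mu> g"
proof -
  \<comment> \<open>Centring at the mean of \<open>g\<close> under \<open>\<mu>\<close>, rather than
    the mean of \<open>f\<close> under \<open>cond_pmf \<mu> K\<close>, makes the final integral
    exactly the variance of \<open>g\<close>.\<close>
  define c where "c = measure_pmf.expectation \<mu> g"
  have g2: "integrable \<mu> (\<lambda>x. (g x)\<^sup>2)"
    using assms(3) by (simp add: l2_def)
  then have g1: "integrable \<mu> g"
    by (intro measure_pmf.square_integrable_imp_integrable[of g \<mu>]) simp_all
  have int: "integrable \<mu> (\<lambda>x. (g x - c)\<^sup>2)"
    using g1 g2 by (simp add: power2_diff)
  have ne: "set_pmf \<mu> \<inter> K \<noteq> {}"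
    using assms(2) measure_pmf_zero_iff[of \<mu> K] by force
  have fin: "finite (set_pmf (cond_pmf \<mu> K))"
    using assms(1) by (simp add: set_cond_pmf[OF ne])
  have "measure_pmf.prob \<mu> K * measure_pmf.variance (cond_pmf \<mu> K) f \<le>
      measure_pmf.prob \<mu> K * measure_pmf.expectation (cond_pmf \<mu> K) (\<lambda>x. (f x - c)\<^sup>2)"
    by (intro mult_left_mono measure_pmf.variance_le_square_deviation
        integrable_measure_pmf_finite fin) simp
  also have "\<dots> = (\<Sum>x\<in>K. pmf \<mu> x * (g x - c)\<^sup>2)"
    using assms(4) by (simp add: expectation_cond_pmf_finite[OF assms(1,2)])
  also have "\<dots> = measure_pmf.expectation \<mu> (\<lambda>x. indicator K x * (g x - c)\<^sup>2)"
    using assms(1)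
    by (subst integral_measure_pmf[where A = K]) (auto simp: indicator_def split: if_splits)
  \<comment> \<open>The integrand discarded outside \<open>K\<close> is nonnegative.\<close>
  also have "\<dots> \<le> measure_pmf.expectation \<mu> (\<lambda>x. (g x - c)\<^sup>2)"
    using integrable_mult_indicator[of K "measure_pmf \<mu>", OF _ int]
    by (intro integral_mono int) (auto simp: indicator_def)
  finally show ?thesis
    by (simp add: c_def)
qed

text \<open>All terms outside \<open>A\<close> vanish, so the form is a finite real number and an
  \<open>ereal\<close> bound involving it becomes a real inequality.\<close>

lemma dirichlet_form_finite_support:
  assumes "finite A" "A \<subseteq> {x. x \<in> S \<and> x + 1 \<in> S}" "\<And>x. x \<notin> A \<Longrightarrow> g x = g (x + 1)"
  shows "dirichlet_form S L \<nu> g = ereal (\<Sum>x\<in>A. pmf \<nu> x * L x (x + 1) * (g x - g (x + 1))\<^sup>2)"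
proof -
  have "dirichlet_form S L \<nu> g =
      (\<Sum>\<^sub>\<infinity>x\<in>A. ereal (pmf \<nu> x * L x (x + 1) * (g x - g (x + 1))\<^sup>2))"
    unfolding dirichlet_form_def using assms(2,3) by (intro infsum_cong_neutral) auto
  then show ?thesis
    using assms(1) by simp
qed

theorem lemma4:
  fixes S K :: "int set" and L :: "int \<Rightarrow> int \<Rightarrow> real" and \<nu> :: "int pmf"
    and m M :: int and C_P :: real
  assumes "birth_death_process S L \<nu>"
    and "K = {m..M}" and "m \<le> M" and "K \<subseteq> S"
    and "measure_pmf.prob \<nu> K > 0"
    and "\<forall>f\<in>l2 \<nu>. ereal (measure_pmf.variance \<nu> f) \<le> ereal C_P * dirichlet_form S L \<nu> f"
  shows "\<forall>f\<in>l2 (cond_pmf \<nu> K). measure_pmf.variance (cond_pmf \<nu> K) f \<le>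
    C_P * (\<Sum>x | x \<in> K \<and> x + 1 \<in> K. edge_measure \<nu> L K x (x + 1) * (f x - f (x + 1))\<^sup>2)"
proof
  fix f :: "int \<Rightarrow> real"
  define A where "A = {x. x \<in> K \<and> x + 1 \<in> K}"
  \<comment> \<open>The constant extension of \<open>f\<close> beyond both ends of \<open>K\<close>:
    its argument is clamped to \<open>{m..M}\<close>.\<close>
  define g where "g x = f (max m (min M x))" for x
  let ?p = "measure_pmf.prob \<nu> K"
  let ?E = "\<Sum>x\<in>A. edge_measure \<nu> L K x (x + 1) * (f x - f (x + 1))\<^sup>2"
  have finK: "finite K"
    using assms(2) by simp
  then have finA: "finite A"
    by (simp add: A_def)
  have gK: "g x = f x" if "x \<in> K" for x
    using that assms(2) by (simp add: g_def)
  \<comment> \<open>All values of \<open>g\<close> are values of \<open>f\<close> on the finite set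
    \<open>K\<close>, so \<open>g\<close> is bounded.\<close>
  have "(g x)\<^sup>2 \<le> (\<Sum>y\<in>K. (f y)\<^sup>2)" for x
    unfolding g_def using finK assms(2,3) by (intro member_le_sum) auto
  then have gl2: "g \<in> l2 \<nu>"
    unfolding l2_def
    by (auto intro!: measure_pmf.integrable_const_bound[where B = "\<Sum>y\<in>K. (f y)\<^sup>2"])
  have gA: "g x = g (x + 1)" if "x \<notin> A" for x
  proof -
    \<comment> \<open>Here \<open>x < m\<close> or \<open>x \<ge> M\<close>, so \<open>x\<close> and
      \<open>x + 1\<close> clamp to the same endpoint; this covers the edges from
      \<open>m - 1\<close> to \<open>m\<close> and from \<open>M\<close> to
      \<open>M + 1\<close>.\<close>
    have "max m (min M x) = max m (min M (x + 1))"
      using that assms(2,3) by (auto simp: A_def)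
    then show ?thesis
      by (simp add: g_def)
  qed
  have ne: "set_pmf \<nu> \<inter> K \<noteq> {}"
    using assms(5) measure_pmf_zero_iff[of \<nu> K] by force
  have "(\<Sum>x\<in>A. pmf \<nu> x * L x (x + 1) * (g x - g (x + 1))\<^sup>2) = ?p * ?E"
    unfolding sum_distrib_left using assms(5)
    by (intro sum.cong refl) (simp add: A_def gK edge_measure_def pmf_cond[OF ne])
  moreover have "A \<subseteq> {x. x \<in> S \<and> x + 1 \<in> S}"
    using assms(4) by (auto simp: A_def)
  ultimately have "dirichlet_form S L \<nu> g = ereal (?p * ?E)"
    using dirichlet_form_finite_support[OF finA, of S g L \<nu>] gA by simp
  then have "measure_pmf.variance \<nu> g \<le> C_P * (?p * ?E)"
    using bspec[OF assms(6) gl2] by simp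
  with variance_cond_pmf_le[OF finK assms(5) gl2 gK]
  have "?p * measure_pmf.variance (cond_pmf \<nu> K) f \<le> ?p * (C_P * ?E)"
    by (simp add: mult.left_commute)
  then show "measure_pmf.variance (cond_pmf \<nu> K) f \<le>
      C_P * (\<Sum>x | x \<in> K \<and> x + 1 \<in> K. edge_measure \<nu> L K x (x + 1) * (f x - f (x + 1))\<^sup>2)"
    using assms(5) by (simp add: A_def)
qed

end
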